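(* There is no $P_2$ set that includes any positive multiple of $3$ (i.e. an element of the form $3k$ with $k$ a positive integer).
   Context: Let $n$ be an integer. A set $\{a_1,a_2,\dots,a_m\}$ of $m$ different positive integers is called a $P_n$ set of size $m$ (equivalently, a Diophantine $m$-tuple with the property $D(n)$) if $a_ia_j+n$ is a perfect square (the square of an integer) for all $1\le i<j\le m$. A $P_2$ set is a $P_n$ set with $n=2$.
   Formalization: The formal statement concerns P_2 sets of size m ≥ 2; for size 1 the condition on pairs is vacuous, so {3} would be a P_2 set containing a multiple of 3 and the claim would fail. *)

theory Defs
  imports "HOL-Computational_Algebra.Nth_Powers"
begin

text \<open>
  The condition is symmetric in the two elements, so quantifying over all pairs of
  distinct elements of the set is the same as quantifying over indices \<open>i < j\<close>.
  The perfect squares are the squares of integers; in particular 0 is one and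
  negative integers are not.  For sets with at most one element the condition is vacuous,
  so results about these sets need the hypothesis \<open>m \<ge> 2\<close>.
\<close>

definition P_set :: "int \<Rightarrow> nat \<Rightarrow> int set \<Rightarrow> bool" where
  "P_set n m A \<longleftrightarrow> finite A \<and> card A = m \<and> (\<forall>a\<in>A. a > 0) \<and>
     (\<forall>a\<in>A. \<forall>b\<in>A. a \<noteq> b \<longrightarrow> is_square (a * b + n))"

end

theory Submission
  imports Defs
begin

text \<open>
  A multiple of \<open>3\<close> contributes nothing modulo \<open>3\<close> to a product, so pairing it with any
  second element of the set (there is one, since \<open>m \<ge> 2\<close>) yields a square congruent to \<open>2\<close>
  modulo \<open>3\<close>. But \<open>2\<close> is a quadratic nonresidue modulo \<open>3\<close>.
\<close>

lemma square_mod_3_neq_2: "x\<^sup>2 mod 3 \<noteq> (2::int)"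
proof -
  have "x mod 3 = 0 \<or> x mod 3 = 1 \<or> x mod 3 = 2" by presburger
  then have "(x mod 3)\<^sup>2 mod 3 \<noteq> 2" by auto
  then show ?thesis by (simp add: power_mod)
qed

theorem mainTheorem7:
  shows "\<not> (\<exists>(m::nat) (A::int set). m \<ge> 2 \<and> P_set 2 m A \<and> (\<exists>k::int. k > 0 \<and> 3 * k \<in> A))"
proof
  assume "\<exists>(m::nat) (A::int set). m \<ge> 2 \<and> P_set 2 m A \<and> (\<exists>k::int. k > 0 \<and> 3 * k \<in> A)"
  then obtain m A k where m: "m \<ge> 2" and P: "P_set 2 m A" and k: "3 * k \<in> A"
    by blast
  have "\<not> A \<subseteq> {3 * k}"
  proof
    assume "A \<subseteq> {3 * k}"
    then have "card A \<le> card {3 * k}" by (intro card_mono) auto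
    with m P show False by (simp add: P_set_def)
  qed
  then obtain b where "b \<in> A" "b \<noteq> 3 * k" by blast
  with P k have "is_square (3 * k * b + 2)"
    unfolding P_set_def by metis
  then obtain x where "3 * k * b + 2 = x\<^sup>2"
    by (auto simp: is_nth_power_def)
  then have "x\<^sup>2 mod 3 = (2 + 3 * (k * b)) mod 3"
    by (simp add: algebra_simps)
  also have "\<dots> = 2" by simp
  finally show False using square_mod_3_neq_2 by blast
qed

end
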